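(* Let $k$ be a field of characteristic zero, let $S=k[x_1,\ldots,x_n]$ be a polynomial ring graded by $\deg(x_i)=d_i>0$, and let $I,J\subseteq S$ be homogeneous ideals with $IJ\neq S$. If $(I,J)$ is a strongly Golod pair, then $IJ$ is strongly Golod.
   Context: For an ideal $I\subseteq S$, $\partial(I)$ denotes the ideal of $S$ generated by all partial derivatives $\partial f/\partial x_i$ of elements $f\in I$, $i=1,\ldots,n$. A proper homogeneous ideal $I\subseteq S$ is called strongly Golod if $\partial(I)^2\subseteq I$. A pair $(I,J)$ of ideals of $S$ is called a strongly Golod pair if $\partial(I)^2\subseteq I:J$ and $\partial(J)^2\subseteq J:I$. *)

theory Defs
  imports Complex_Main "HOL-Library.Poly_Mapping"
begin

type_synonym ('n, 'k) mpoly = "('n \<Rightarrow>\<^sub>0 nat) \<Rightarrow>\<^sub>0 'k"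

text \<open>
  An element of \<^typ>\<open>('n, 'k) mpoly\<close> is a finitely supported map from exponent vectors to
  coefficients; multiplication is convolution. For a finite type \<^typ>\<open>'n\<close> with \<open>n\<close> elements and a
  field \<^typ>\<open>'k\<close> the whole type is the polynomial ring \<open>k[x\<^sub>1, \<dots>, x\<^sub>n]\<close>.
\<close>

text \<open>Ideals are the submodules of a commutative ring acting on itself by multiplication.\<close>

global_interpretation ideal: module "times :: 'a::comm_ring_1 \<Rightarrow> 'a \<Rightarrow> 'a"
  by standard (simp_all add: algebra_simps)

abbreviation is_ideal :: "'a::comm_ring_1 set \<Rightarrow> bool" where
  "is_ideal \<equiv> ideal.subspace"

abbreviation ideal_gen :: "'a::comm_ring_1 set \<Rightarrow> 'a set" where
  "ideal_gen \<equiv> ideal.span"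

definition ideal_prod :: "'a::comm_ring_1 set \<Rightarrow> 'a set \<Rightarrow> 'a set" where
  "ideal_prod I J = ideal_gen {f * g | f g. f \<in> I \<and> g \<in> J}"

definition ideal_colon :: "'a::comm_ring_1 set \<Rightarrow> 'a set \<Rightarrow> 'a set" where
  "ideal_colon I J = {f. \<forall>g\<in>J. f * g \<in> I}"

text \<open>
  The derivative of \<open>c x\<^sup>m\<close> is \<open>m\<^sub>i c x\<^sup>m\<^sup>-\<^sup>e\<close>, where \<open>e\<close> is the \<open>i\<close>-th unit vector. The subtraction of
  exponents is truncated when \<open>m\<^sub>i = 0\<close>, but then the coefficient vanishes.
\<close>

definition partial_deriv :: "'n \<Rightarrow> ('n, 'k::comm_ring_1) mpoly \<Rightarrow> ('n, 'k) mpoly" where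
  "partial_deriv i f =
    (\<Sum>m\<in>Poly_Mapping.keys f.
      Poly_Mapping.single (m - Poly_Mapping.single i 1)
        (of_nat (Poly_Mapping.lookup m i) * Poly_Mapping.lookup f m))"

definition deriv_ideal :: "('n, 'k::comm_ring_1) mpoly set \<Rightarrow> ('n, 'k) mpoly set" where
  "deriv_ideal I = ideal_gen {partial_deriv i f | i f. f \<in> I}"

definition wdegree :: "('n::finite \<Rightarrow> nat) \<Rightarrow> ('n \<Rightarrow>\<^sub>0 nat) \<Rightarrow> nat" where
  "wdegree d m = (\<Sum>i\<in>UNIV. d i * Poly_Mapping.lookup m i)"

text \<open>The zero polynomial is homogeneous of every degree.\<close>

definition homogeneous :: "('n::finite \<Rightarrow> nat) \<Rightarrow> ('n, 'k::comm_ring_1) mpoly \<Rightarrow> bool" where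
  "homogeneous d f \<longleftrightarrow> (\<exists>e. \<forall>m\<in>Poly_Mapping.keys f. wdegree d m = e)"

definition homogeneous_ideal :: "('n::finite \<Rightarrow> nat) \<Rightarrow> ('n, 'k::comm_ring_1) mpoly set \<Rightarrow> bool" where
  "homogeneous_ideal d I \<longleftrightarrow> (\<exists>G. (\<forall>g\<in>G. homogeneous d g) \<and> I = ideal_gen G)"

definition strongly_Golod :: "('n::finite \<Rightarrow> nat) \<Rightarrow> ('n, 'k::comm_ring_1) mpoly set \<Rightarrow> bool" where
  "strongly_Golod d I \<longleftrightarrow>
    homogeneous_ideal d I \<and> I \<noteq> UNIV \<and> ideal_prod (deriv_ideal I) (deriv_ideal I) \<subseteq> I"

definition strongly_Golod_pair ::
  "('n, 'k::comm_ring_1) mpoly set \<Rightarrow> ('n, 'k) mpoly set \<Rightarrow> bool" where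
  "strongly_Golod_pair I J \<longleftrightarrow>
    is_ideal I \<and> is_ideal J \<and>
    ideal_prod (deriv_ideal I) (deriv_ideal I) \<subseteq> ideal_colon I J \<and>
    ideal_prod (deriv_ideal J) (deriv_ideal J) \<subseteq> ideal_colon J I"

end

theory Submission
  imports Defs
begin

text \<open>
  The Leibniz rule places \<open>\<partial>(IJ)\<close> inside \<open>\<partial>(I) J + I \<partial>(J)\<close>. The square of that sum is
  \<open>\<partial>(I)\<^sup>2 J\<^sup>2 + \<partial>(I) \<partial>(J) I J + \<partial>(J)\<^sup>2 I\<^sup>2\<close>. The mixed term visibly lies in \<open>IJ\<close>. The pair condition
  absorbs the two others: \<open>\<partial>(I)\<^sup>2 J \<subseteq> I\<close> gives \<open>\<partial>(I)\<^sup>2 J\<^sup>2 \<subseteq> IJ\<close>, and \<open>\<partial>(J)\<^sup>2 I \<subseteq> J\<close> gives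
  \<open>\<partial>(J)\<^sup>2 I\<^sup>2 \<subseteq> IJ\<close>. Homogeneity of \<open>IJ\<close> holds because the products of homogeneous generators of
  \<open>I\<close> and \<open>J\<close> are homogeneous and generate \<open>IJ\<close>.

  The inclusions of products of ideals are checked on generators
  (\<open>mult_mem_ideal_of_generators\<close>), so the only computation is the Leibniz rule
  \<open>partial_deriv_mult\<close>, which by biadditivity is a statement about two monomials.
\<close>

section \<open>Partial derivatives\<close>

lemma partial_deriv_eq_sum_superset:
  assumes "finite A" "Poly_Mapping.keys f \<subseteq> A"
  shows "partial_deriv i f =
    (\<Sum>m\<in>A. Poly_Mapping.single (m - Poly_Mapping.single i 1)
        (of_nat (Poly_Mapping.lookup m i) * Poly_Mapping.lookup f m))"
  unfolding partial_deriv_def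
  by (rule sum.mono_neutral_left[OF assms]) (simp add: not_in_keys_iff_lookup_eq_zero)

lemma partial_deriv_zero [simp]: "partial_deriv i 0 = 0"
  by (simp add: partial_deriv_def)

lemma partial_deriv_add: "partial_deriv i (f + g) = partial_deriv i f + partial_deriv i g"
proof -
  let ?A = "Poly_Mapping.keys f \<union> Poly_Mapping.keys g"
  have fin: "finite ?A" by simp
  show ?thesis
    unfolding partial_deriv_eq_sum_superset[OF fin Poly_Mapping.keys_add]
      partial_deriv_eq_sum_superset[OF fin Un_upper1]
      partial_deriv_eq_sum_superset[OF fin Un_upper2]
    by (simp add: lookup_add distrib_left single_add sum.distrib)
qed

lemma partial_deriv_single:
  "partial_deriv i (Poly_Mapping.single m c) =
    Poly_Mapping.single (m - Poly_Mapping.single i 1) (of_nat (Poly_Mapping.lookup m i) * c)"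
  by (subst partial_deriv_eq_sum_superset[of "{m}"]) auto

lemma poly_mapping_additive_induct [case_names zero single add]:
  assumes "P 0" and "\<And>m c. P (Poly_Mapping.single m c)" and "\<And>f g. P f \<Longrightarrow> P g \<Longrightarrow> P (f + g)"
  shows "P f"
proof (induction f rule: update_induct)
  case const
  show ?case by (rule assms(1))
next
  case (update f m c)
  have "Poly_Mapping.update m c f = f + Poly_Mapping.single m c"
    using update(1) by (intro poly_mapping_eqI)
      (auto simp: lookup_update lookup_add lookup_single when_def not_in_keys_iff_lookup_eq_zero)
  then show ?case using update assms(2,3) by simp
qed

lemma partial_deriv_mult_single:
  "partial_deriv i (Poly_Mapping.single m a * Poly_Mapping.single n b) =
    partial_deriv i (Poly_Mapping.single m a) * Poly_Mapping.single n b +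
    Poly_Mapping.single m a * partial_deriv i (Poly_Mapping.single n b)"
proof -
  let ?e = "Poly_Mapping.single i (1::nat)"
  \<comment> \<open>If \<open>x\<^sub>i\<close> does not divide \<open>x\<^sup>m\<close>, truncation leaves \<open>m - ?e = m\<close> and the two exponents may
    differ, but then both coefficients are zero.\<close>
  have left: "Poly_Mapping.single (m - ?e + n) (of_nat (Poly_Mapping.lookup m i) * a * b) =
    Poly_Mapping.single (m + n - ?e) (of_nat (Poly_Mapping.lookup m i) * a * b)"
    for m n a and b :: 'b
  proof (cases "Poly_Mapping.lookup m i = 0")
    case False
    then have "m - ?e + n = m + n - ?e"
      by (intro poly_mapping_eqI) (auto simp: lookup_add lookup_minus lookup_single when_def)
    then show ?thesis by simp
  qed simp
  have right: "Poly_Mapping.single (m + (n - ?e)) (a * (of_nat (Poly_Mapping.lookup n i) * b)) =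
    Poly_Mapping.single (m + n - ?e) (of_nat (Poly_Mapping.lookup n i) * a * b)"
    using left[of n m a b] unfolding add.commute[of _ m] mult.assoc mult.left_commute[of a] .
  show ?thesis
    unfolding mult_single partial_deriv_single left right lookup_add
    unfolding single_add[symmetric] of_nat_add distrib_right mult.assoc ..
qed

lemma partial_deriv_mult:
  "partial_deriv i (f * g) = partial_deriv i f * g + f * partial_deriv i g"
proof (induction f rule: poly_mapping_additive_induct)
  case zero
  show ?case by simp
next
  case (single m a)
  show ?case
  proof (induction g rule: poly_mapping_additive_induct)
    case zero
    show ?case by simp
  next
    case (single n b)
    show ?case by (rule partial_deriv_mult_single)
  next
    case (add g1 g2)
    then show ?case by (simp only: partial_deriv_add distrib_left distrib_right ac_simps)
  qed
next
  case (add f1 f2)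
  then show ?case by (simp only: partial_deriv_add distrib_left distrib_right ac_simps)
qed

section \<open>Products of ideals\<close>

text \<open>
  For fixed \<open>w\<close>, the elements that multiply \<open>w\<close> into an ideal form an ideal. This extends the
  hypothesis from generators to spans in one factor at a time.
\<close>

lemma mult_mem_ideal_of_generators:
  assumes "is_ideal N" and "\<And>a b. a \<in> A \<Longrightarrow> b \<in> B \<Longrightarrow> a * b \<in> N"
    and "x \<in> ideal_gen A" and "y \<in> ideal_gen B"
  shows "x * y \<in> N"
proof -
  have colon_ideal: "is_ideal {z. z * w \<in> N}" for w
    \<comment> \<open>The module law \<open>ideal.scale_scale\<close> is \<open>mult.assoc\<close> read backwards; together they loop.\<close>
    using assms(1) by (simp add: ideal.subspace_def distrib_right mult.assoc del: ideal.scale_scale)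
  have "x * b \<in> N" if "b \<in> B" for b
  proof -
    have "A \<subseteq> {z. z * b \<in> N}" using assms(2) that by blast
    from ideal.span_minimal[OF this colon_ideal] show ?thesis using assms(3) by blast
  qed
  then have "B \<subseteq> {z. z * x \<in> N}" unfolding mult.commute[of _ x] by blast
  from ideal.span_minimal[OF this colon_ideal] have "y * x \<in> N" using assms(4) by blast
  then show ?thesis by (simp only: mult.commute)
qed

lemma is_ideal_ideal_prod: "is_ideal (ideal_prod I J)"
  by (simp add: ideal_prod_def)

lemma mult_mem_ideal_prod: "f \<in> I \<Longrightarrow> g \<in> J \<Longrightarrow> f * g \<in> ideal_prod I J"
  unfolding ideal_prod_def by (rule ideal.span_base) blast

lemma ideal_prod_subset:
  assumes "is_ideal N" and "\<And>f g. f \<in> I \<Longrightarrow> g \<in> J \<Longrightarrow> f * g \<in> N"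
  shows "ideal_prod I J \<subseteq> N"
  unfolding ideal_prod_def by (rule ideal.span_minimal[OF _ assms(1)]) (use assms(2) in blast)

lemma ideal_prod_ideal_gen:
  "ideal_prod (ideal_gen G) (ideal_gen H) = ideal_gen {g * h | g h. g \<in> G \<and> h \<in> H}"
    (is "_ = ideal_gen ?P")
proof
  have "g * h \<in> ideal_gen ?P" if "g \<in> G" "h \<in> H" for g h
    by (rule ideal.span_base) (use that in blast)
  from mult_mem_ideal_of_generators[OF ideal.subspace_span this]
  show "ideal_prod (ideal_gen G) (ideal_gen H) \<subseteq> ideal_gen ?P"
    by (rule ideal_prod_subset[OF ideal.subspace_span])
  have "?P \<subseteq> ideal_prod (ideal_gen G) (ideal_gen H)"
    using mult_mem_ideal_prod[OF ideal.span_base ideal.span_base] by blast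
  then show "ideal_gen ?P \<subseteq> ideal_prod (ideal_gen G) (ideal_gen H)"
    by (rule ideal.span_minimal[OF _ is_ideal_ideal_prod])
qed

section \<open>Homogeneity\<close>

lemma wdegree_add: "wdegree d (m + n) = wdegree d m + wdegree d n"
  by (simp add: wdegree_def lookup_add distrib_left sum.distrib)

lemma homogeneous_mult:
  assumes "homogeneous d f" "homogeneous d g"
  shows "homogeneous d (f * g)"
proof -
  obtain e e' where "\<forall>m\<in>Poly_Mapping.keys f. wdegree d m = e"
    and "\<forall>m\<in>Poly_Mapping.keys g. wdegree d m = e'"
    using assms unfolding homogeneous_def by blast
  then have "wdegree d m = e + e'" if "m \<in> Poly_Mapping.keys (f * g)" for m
    using subsetD[OF keys_mult that] wdegree_add[of d] by auto
  then show ?thesis unfolding homogeneous_def by blast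
qed

lemma homogeneous_ideal_ideal_prod:
  assumes "homogeneous_ideal d I" "homogeneous_ideal d J"
  shows "homogeneous_ideal d (ideal_prod I J)"
proof -
  obtain G H where G: "\<forall>g\<in>G. homogeneous d g" "I = ideal_gen G"
    and H: "\<forall>h\<in>H. homogeneous d h" "J = ideal_gen H"
    using assms unfolding homogeneous_ideal_def by blast
  have "\<forall>p\<in>{g * h | g h. g \<in> G \<and> h \<in> H}. homogeneous d p"
    using G(1) H(1) homogeneous_mult by blast
  moreover have "ideal_prod I J = ideal_gen {g * h | g h. g \<in> G \<and> h \<in> H}"
    by (simp add: G(2) H(2) ideal_prod_ideal_gen)
  ultimately show ?thesis unfolding homogeneous_ideal_def by blast
qed

section \<open>The derivative ideal of a product\<close>

lemma partial_deriv_mem_deriv_ideal: "f \<in> I \<Longrightarrow> partial_deriv i f \<in> deriv_ideal I"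
  unfolding deriv_ideal_def by (rule ideal.span_base) blast

text \<open>
  An element of \<open>IJ\<close> is a sum of terms \<open>c f g\<close>. The coefficient \<open>c\<close> is absorbed into \<open>f\<close> before the
  Leibniz rule is applied, so no term with a derivative of \<open>c\<close> appears.
\<close>

lemma deriv_ideal_ideal_prod_subset:
  assumes "is_ideal I"
  shows "deriv_ideal (ideal_prod I J) \<subseteq>
    ideal_gen ({a * g | a g. a \<in> deriv_ideal I \<and> g \<in> J} \<union>
      {f * b | f b. f \<in> I \<and> b \<in> deriv_ideal J})"
    (is "_ \<subseteq> ideal_gen ?K")
proof -
  have "partial_deriv i p \<in> ideal_gen ?K" if "p \<in> ideal_prod I J" for i p
    using that unfolding ideal_prod_def
  proof (induction p rule: ideal.span_induct_alt)
    case base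
    then show ?case by (simp add: ideal.span_zero)
  next
    case (step c p q)
    then obtain f g where fg: "p = f * g" "f \<in> I" "g \<in> J" by blast
    have "c * f \<in> I" using ideal.subspace_scale[OF assms] fg(2) by blast
    then have "partial_deriv i (c * f) * g \<in> ?K" "(c * f) * partial_deriv i g \<in> ?K"
      using fg(3) partial_deriv_mem_deriv_ideal[of "c * f" I i]
        partial_deriv_mem_deriv_ideal[of g J i] by blast+
    then have "partial_deriv i ((c * f) * g) \<in> ideal_gen ?K"
      unfolding partial_deriv_mult by (intro ideal.span_add ideal.span_base)
    then have "partial_deriv i (c * p) \<in> ideal_gen ?K" by (simp only: fg(1) mult.assoc)
    then show ?case unfolding partial_deriv_add by (rule ideal.span_add) (rule step.IH)
  qed
  then show ?thesis
    unfolding deriv_ideal_def[of "ideal_prod I J"]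
    by (intro ideal.span_minimal ideal.subspace_span) blast
qed

lemma deriv_ideal_mult_mem:
  assumes "ideal_prod (deriv_ideal I) (deriv_ideal I) \<subseteq> ideal_colon I J"
    and "a \<in> deriv_ideal I" "a' \<in> deriv_ideal I" "g \<in> J"
  shows "a * a' * g \<in> I"
  using assms mult_mem_ideal_prod[of a "deriv_ideal I" a' "deriv_ideal I"]
  by (auto simp: ideal_colon_def)

lemma deriv_ideal_ideal_prod_mult_mem:
  assumes "strongly_Golod_pair I J"
    and "x \<in> deriv_ideal (ideal_prod I J)" "y \<in> deriv_ideal (ideal_prod I J)"
  shows "x * y \<in> ideal_prod I J"
proof -
  have I: "is_ideal I"
    and II: "ideal_prod (deriv_ideal I) (deriv_ideal I) \<subseteq> ideal_colon I J"
    and JJ: "ideal_prod (deriv_ideal J) (deriv_ideal J) \<subseteq> ideal_colon J I"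
    using assms(1) by (auto simp: strongly_Golod_pair_def)
  have mixed: "(a * g) * (f * b) \<in> ideal_prod I J" if "f \<in> I" "g \<in> J" for a b f g
    using ideal.subspace_scale[OF is_ideal_ideal_prod mult_mem_ideal_prod[OF that], of "a * b"]
    by (simp only: mult_ac)
  have square_I: "(a * g) * (a' * g') \<in> ideal_prod I J"
    if "a \<in> deriv_ideal I" "g \<in> J" "a' \<in> deriv_ideal I" "g' \<in> J" for a g a' g'
    using mult_mem_ideal_prod[OF deriv_ideal_mult_mem[OF II that(1,3,2)] that(4)]
    by (simp only: mult_ac)
  have square_J: "(f * b) * (f' * b') \<in> ideal_prod I J"
    if "b \<in> deriv_ideal J" "f \<in> I" "b' \<in> deriv_ideal J" "f' \<in> I" for b f b' f'
    using mult_mem_ideal_prod[OF that(4) deriv_ideal_mult_mem[OF JJ that(1,3,2)]]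
    by (simp only: mult_ac)
  show ?thesis
  proof (rule mult_mem_ideal_of_generators[OF is_ideal_ideal_prod])
    show "x \<in> ideal_gen ({a * g | a g. a \<in> deriv_ideal I \<and> g \<in> J} \<union>
      {f * b | f b. f \<in> I \<and> b \<in> deriv_ideal J})"
      and "y \<in> ideal_gen ({a * g | a g. a \<in> deriv_ideal I \<and> g \<in> J} \<union>
      {f * b | f b. f \<in> I \<and> b \<in> deriv_ideal J})"
      using deriv_ideal_ideal_prod_subset[OF I] assms(2,3) by blast+
  next
    fix u v
    assume "u \<in> {a * g | a g. a \<in> deriv_ideal I \<and> g \<in> J} \<union>
        {f * b | f b. f \<in> I \<and> b \<in> deriv_ideal J}"
      and "v \<in> {a * g | a g. a \<in> deriv_ideal I \<and> g \<in> J} \<union>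
        {f * b | f b. f \<in> I \<and> b \<in> deriv_ideal J}"
    then consider
        a g a' g' where "u = a * g" "v = a' * g'"
          "a \<in> deriv_ideal I" "g \<in> J" "a' \<in> deriv_ideal I" "g' \<in> J"
      | a g f b where "u = a * g" "v = f * b" "f \<in> I" "g \<in> J"
      | f b a g where "u = f * b" "v = a * g" "f \<in> I" "g \<in> J"
      | f b f' b' where "u = f * b" "v = f' * b'"
          "b \<in> deriv_ideal J" "f \<in> I" "b' \<in> deriv_ideal J" "f' \<in> I"
      by blast
    then show "u * v \<in> ideal_prod I J"
    proof cases
      case 1
      then show ?thesis using square_I by simp
    next
      case 2
      then show ?thesis using mixed by simp
    next
      case 3
      then show ?thesis using mixed[of f g a b] by (simp only: mult.commute)
    next
      case 4
      then show ?thesis using square_J by simp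
    qed
  qed
qed

theorem proposition5p2:
  fixes I J :: "('n::finite, 'k::field_char_0) mpoly set"
    and d :: "'n \<Rightarrow> nat"
  assumes "\<And>i. d i > 0"
    and "homogeneous_ideal d I" and "homogeneous_ideal d J"
    and "ideal_prod I J \<noteq> UNIV"
    and "strongly_Golod_pair I J"
  shows "strongly_Golod d (ideal_prod I J)"
  unfolding strongly_Golod_def
proof (intro conjI)
  show "homogeneous_ideal d (ideal_prod I J)"
    using assms(2,3) by (rule homogeneous_ideal_ideal_prod)
  show "ideal_prod I J \<noteq> UNIV" by fact
  show "ideal_prod (deriv_ideal (ideal_prod I J)) (deriv_ideal (ideal_prod I J))
      \<subseteq> ideal_prod I J"
    by (intro ideal_prod_subset is_ideal_ideal_prod deriv_ideal_ideal_prod_mult_mem[OF assms(5)])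
qed

end
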